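(* Let $H\le F$ be a subgroup and let $T$ be any spanning tree, rooted at $o=H$, of the Schreier graph $X=H\backslash F$. Let $\Omega\subset\partial F$ and $\Delta\subset\partial F$ be the associated Schreier limit set and Schreier fundamental domain. Then there is a disjoint decomposition $$\partial F=\Bigl(\bigsqcup_{h\in H}h\Delta\Bigr)\sqcup\Omega ,$$ i.e. the sets $h\Delta$ $(h\in H)$ and $\Omega$ are pairwise disjoint and their union is $\partial F$.
   Context: $F$ is the free group freely generated by a finite set $\mathcal A$ with $|\mathcal A|=m\ge 2$; $\breve{\mathcal A}=\mathcal A\sqcup\mathcal A^{-1}$. Elements of $F$ are identified with finite freely reduced words in $\breve{\mathcal A}$. The boundary $\partial F$ is the set of infinite (to the right) freely reduced words in $\breve{\mathcal A}$ with the product topology of pointwise convergence; $F$ acts on $\partial F$ by concatenation followed by free reduction. A sequence $g_n\in F$ converges to $\omega\in\partial F$ if the reduced words of $g_n$ converge pointwise to $\omega$. Schreier graph: $X=H\backslash F$ has the cosets $Hg$ as vertices and, for each vertex $x$ and each $a\in\breve{\mathcal A}$, an oriented edge from $x$ to $xa$ labelled $a$, whose reversal is the edge from $xa$ to $x$ labelled $a^{-1}$ (loops and multiple edges are allowed). The origin is $o=H$. For a spanning tree $T$ rooted at $o$, $[x,y]_T$ denotes the unique geodesic in $T$ from $x$ to $y$. Schreier generators: for every oriented edge $\mathcal E=[x,y]$ of $X$ not in $T$, let $s_{\mathcal E}\in H$ be the element whose word is read along the path $[o,x]_T\,[x,y]\,[y,o]_T$; write this word as $\sigma_-(s)\sigma_0(s)\sigma_+(s)$,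 the three factors being read along $[o,x]_T$, $[x,y]$, $[y,o]_T$ respectively. The set of all $s_{\mathcal E}$ is $\breve{\mathcal S}=\mathcal S\sqcup\mathcal S^{-1}$, where $\mathcal S$ consists of those $s$ with $\sigma_0(s)\in\mathcal A$; $\mathcal E\mapsto s_{\mathcal E}$ is a bijection between the oriented edges not in $T$ and $\breve{\mathcal S}$, and $H$ is freely generated by $\mathcal S$. Let $\partial H$ be the set of infinite freely reduced words $\xi=s_1s_2\dots$ in the alphabet $\breve{\mathcal S}$. For every $\xi\in\partial H$ the limit $\sigma^\infty(\xi)=\lim_n s_1s_2\cdots s_n\in\partial F$ exists. The Schreier limit set is $\Omega=\sigma^\infty(\partial H)$. The Schreier fundamental domain $\Delta$ is the set of all infinite words in $\partial F$ which do not begin with any of the segments $\sigma_-(s)\sigma_0(s)$, $s\in\breve{\mathcal S}$. *)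

theory Defs
  imports "HOL-Algebra.Coset" "HOL-Library.Stream" "HOL-Library.Disjoint_Sets"
    "HOL-Library.Cardinality" "Graph_Theory.Digraph_Component"
begin

section \<open>The free group and its boundary\<close>

text \<open>The free generating set is the type \<open>'a\<close>. The letter \<open>(a, True)\<close> stands for the
  generator \<open>a\<close> and \<open>(a, False)\<close> for its formal inverse.\<close>

type_synonym 'a letter = "'a \<times> bool"

definition linv :: "'a letter \<Rightarrow> 'a letter" where
  "linv = (\<lambda>(a, b). (a, \<not> b))"

definition reduced :: "'a letter list \<Rightarrow> bool" where
  "reduced = successively (\<lambda>x y. y \<noteq> linv x)"

text \<open>\<open>lcons x w\<close> is the reduced form of \<open>x # w\<close> if \<open>w\<close> is reduced.\<close>

definition lcons :: "'a letter \<Rightarrow> 'a letter list \<Rightarrow> 'a letter list" where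
  "lcons x w = (if w \<noteq> [] \<and> hd w = linv x then tl w else x # w)"

definition free_reduce :: "'a letter list \<Rightarrow> 'a letter list" where
  "free_reduce w = foldr lcons w []"

definition free_group :: "'a letter list monoid" where
  "free_group = \<lparr>carrier = {w. reduced w}, monoid.mult = (\<lambda>u v. free_reduce (u @ v)), one = []\<rparr>"

lemma linv_linv [simp]: "linv (linv x) = x"
  by (simp add: linv_def split: prod.splits)

lemma reduced_Nil [simp]: "reduced []"
  by (simp add: reduced_def)

lemma reduced_Cons: "reduced (x # w) \<longleftrightarrow> reduced w \<and> (w = [] \<or> hd w \<noteq> linv x)"
  by (cases w) (auto simp: reduced_def)

lemma reduced_lcons: "reduced w \<Longrightarrow> reduced (lcons x w)"
  by (cases w) (auto simp: lcons_def reduced_Cons)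

lemma reduced_foldr_lcons: "reduced w \<Longrightarrow> reduced (foldr lcons u w)"
  by (induction u) (auto intro: reduced_lcons)

lemma reduced_free_reduce: "reduced (free_reduce w)"
  by (simp add: free_reduce_def reduced_foldr_lcons)

lemma free_reduce_id: "reduced w \<Longrightarrow> free_reduce w = w"
  by (induction w) (auto simp: free_reduce_def reduced_Cons lcons_def)

lemma lcons_linv: "reduced w \<Longrightarrow> lcons x (lcons (linv x) w) = w"
  by (cases w) (auto simp: lcons_def reduced_Cons)

lemma foldr_lcons_lcons:
  assumes "reduced u" "reduced w"
  shows "foldr lcons (lcons x u) w = lcons x (foldr lcons u w)"
proof (cases "u \<noteq> [] \<and> hd u = linv x")
  case True
  then obtain u' where "u = linv x # u'"
    by (cases u) auto
  then show ?thesis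
    using assms by (simp add: lcons_def[of x "linv x # u'"] lcons_linv reduced_foldr_lcons)
qed (auto simp: lcons_def[of x u])

lemma foldr_lcons_foldr:
  assumes "reduced v" "reduced w"
  shows "foldr lcons (foldr lcons u v) w = foldr lcons u (foldr lcons v w)"
  by (induction u) (simp_all add: assms foldr_lcons_lcons reduced_foldr_lcons)

lemma free_reduce_append: "reduced v \<Longrightarrow> free_reduce (u @ v) = foldr lcons u v"
  using free_reduce_id[of v] by (simp add: free_reduce_def)

lemma group_free_group: "group free_group"
proof (rule groupI)
  fix u :: "'a letter list"
  assume "u \<in> carrier free_group"
  then have u: "reduced u"
    by (simp add: free_group_def)
  have inv: "foldr lcons (rev (map linv w)) (foldr lcons w z) = z" if "reduced z"
    for w z :: "'a letter list"
    using that
  proof (induction w)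
    case (Cons x w)
    then show ?case
      using lcons_linv[of "foldr lcons w z" "linv x"] by (simp add: reduced_foldr_lcons)
  qed simp
  have "foldr lcons u [] = u"
    using free_reduce_id[OF u] by (simp add: free_reduce_def)
  then have "foldr lcons (free_reduce (rev (map linv u))) u = []"
    using inv[of "[]" u] u by (simp add: free_reduce_def foldr_lcons_foldr)
  then have "free_reduce (rev (map linv u)) \<otimes>\<^bsub>free_group\<^esub> u = \<one>\<^bsub>free_group\<^esub>"
    using u by (simp add: free_group_def free_reduce_append)
  then show "\<exists>v \<in> carrier free_group. v \<otimes>\<^bsub>free_group\<^esub> u = \<one>\<^bsub>free_group\<^esub>"
    by (rule bexI) (simp add: free_group_def reduced_free_reduce)
qed (simp_all add: free_group_def reduced_free_reduce free_reduce_append free_reduce_id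
  reduced_foldr_lcons foldr_lcons_foldr)

text \<open>Infinite freely reduced words over a set of letters with a given inversion map. It is
  used for the alphabet of \<open>F\<close> as well as for the alphabet of Schreier generators.\<close>

definition infinite_reduced_words :: "('l \<Rightarrow> 'l) \<Rightarrow> 'l set \<Rightarrow> 'l stream set" where
  "infinite_reduced_words i A = {\<omega> \<in> streams A. \<forall>n. \<omega> !! Suc n \<noteq> i (\<omega> !! n)}"

definition boundary :: "'a letter stream set" where
  "boundary = infinite_reduced_words linv UNIV"

definition scons :: "'a letter \<Rightarrow> 'a letter stream \<Rightarrow> 'a letter stream" where
  "scons x \<omega> = (if shd \<omega> = linv x then stl \<omega> else x ## \<omega>)"

text \<open>Concatenation followed by free reduction, performed one letter of \<open>g\<close> at a time,
  starting with the last one.\<close>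

definition act :: "'a letter list \<Rightarrow> 'a letter stream \<Rightarrow> 'a letter stream" where
  "act g \<omega> = foldr scons g \<omega>"

definition converges_to :: "(nat \<Rightarrow> 'a letter list) \<Rightarrow> 'a letter stream \<Rightarrow> bool" where
  "converges_to g \<omega> \<longleftrightarrow> (\<forall>i. \<forall>\<^sub>F n in sequentially. i < length (g n) \<and> g n ! i = \<omega> !! i)"


section \<open>Schreier graphs and spanning trees\<close>

text \<open>The edge \<open>(x, a)\<close> is the one which leaves the coset \<open>x\<close> and is labelled \<open>a\<close>.\<close>

type_synonym 'a edge = "'a letter list set \<times> 'a letter"

definition schreier_graph ::
  "'a letter list set \<Rightarrow> ('a letter list set, 'a edge) pre_digraph" where
  "schreier_graph H =
    \<lparr>verts = rcosets\<^bsub>free_group\<^esub> H, arcs = (rcosets\<^bsub>free_group\<^esub> H) \<times> UNIV,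
     tail = fst, head = (\<lambda>(x, a). x #>\<^bsub>free_group\<^esub> [a])\<rparr>"

definition edge_rev :: "'a edge \<Rightarrow> 'a edge" where
  "edge_rev = (\<lambda>(x, a). (x #>\<^bsub>free_group\<^esub> [a], linv a))"

text \<open>A subgraph of the Schreier graph is a set of edges closed under reversal. As edges come
  in pairs of opposite orientation, the directed cycles \<open>[e, edge_rev e]\<close> do not count as
  cycles of the unoriented graph, whereas loops and pairs of parallel edges do. (The constant
  \<open>Digraph_Component.tree\<close> only excludes directed cycles, and it does not make an
  exception for \<open>[e, edge_rev e]\<close>.)\<close>

definition schreier_spanning_tree ::
  "'a letter list set \<Rightarrow> ('a letter list set, 'a edge) pre_digraph \<Rightarrow> bool" where
  "schreier_spanning_tree H T \<longleftrightarrow>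
    spanning T (schreier_graph H) \<and> edge_rev ` arcs T \<subseteq> arcs T \<and> connected T \<and>
    (\<forall>p. pre_digraph.cycle T p \<longrightarrow> (\<exists>e. p = [e, edge_rev e]))"

definition geodesic :: "('v, 'e) pre_digraph \<Rightarrow> 'v \<Rightarrow> 'v \<Rightarrow> 'e list" where
  "geodesic T x y = (THE p. pre_digraph.awalk T x p y \<and>
    (\<forall>q. pre_digraph.awalk T x q y \<longrightarrow> length p \<le> length q))"


section \<open>Schreier generators, limit set and fundamental domain\<close>

text \<open>The origin of the Schreier graph is the vertex \<open>H\<close>. The three parts of a Schreier
  generator are indexed by the corresponding edge outside of the tree.\<close>

definition sigma_minus ::
  "'a letter list set \<Rightarrow> ('a letter list set, 'a edge) pre_digraph \<Rightarrow> 'a edge \<Rightarrow> 'a letter list" where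
  "sigma_minus H T e = map snd (geodesic T H (tail (schreier_graph H) e))"

definition sigma_zero :: "'a edge \<Rightarrow> 'a letter list" where
  "sigma_zero e = [snd e]"

definition sigma_plus ::
  "'a letter list set \<Rightarrow> ('a letter list set, 'a edge) pre_digraph \<Rightarrow> 'a edge \<Rightarrow> 'a letter list" where
  "sigma_plus H T e = map snd (geodesic T (head (schreier_graph H) e) H)"

definition non_tree_edges ::
  "'a letter list set \<Rightarrow> ('a letter list set, 'a edge) pre_digraph \<Rightarrow> 'a edge set" where
  "non_tree_edges H T = arcs (schreier_graph H) - arcs T"

text \<open>The word below is freely reduced if \<open>e\<close> is not in \<open>T\<close>, so that it is an element of \<open>F\<close>.\<close>

definition schreier_gen ::
  "'a letter list set \<Rightarrow> ('a letter list set, 'a edge) pre_digraph \<Rightarrow> 'a edge \<Rightarrow> 'a letter list" where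
  "schreier_gen H T e = sigma_minus H T e @ sigma_zero e @ sigma_plus H T e"

definition schreier_gens ::
  "'a letter list set \<Rightarrow> ('a letter list set, 'a edge) pre_digraph \<Rightarrow> 'a letter list set" where
  "schreier_gens H T = schreier_gen H T ` non_tree_edges H T"

text \<open>The formal inverse of a letter of the Schreier alphabet is its inverse in \<open>F\<close>.\<close>

definition subgroup_boundary ::
  "'a letter list set \<Rightarrow> ('a letter list set, 'a edge) pre_digraph \<Rightarrow> 'a letter list stream set" where
  "subgroup_boundary H T = infinite_reduced_words (m_inv free_group) (schreier_gens H T)"

definition sigma_infinity :: "'a letter list stream \<Rightarrow> 'a letter stream" where
  "sigma_infinity \<xi> = (THE \<omega>. \<omega> \<in> boundary \<and>
    converges_to (\<lambda>n. foldl (\<otimes>\<^bsub>free_group\<^esub>) \<one>\<^bsub>free_group\<^esub> (stake n \<xi>)) \<omega>)"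

definition limit_set ::
  "'a letter list set \<Rightarrow> ('a letter list set, 'a edge) pre_digraph \<Rightarrow> 'a letter stream set" where
  "limit_set H T = sigma_infinity ` subgroup_boundary H T"

definition begins_with :: "'l stream \<Rightarrow> 'l list \<Rightarrow> bool" where
  "begins_with \<omega> u \<longleftrightarrow> stake (length u) \<omega> = u"

definition fundamental_domain ::
  "'a letter list set \<Rightarrow> ('a letter list set, 'a edge) pre_digraph \<Rightarrow> 'a letter stream set" where
  "fundamental_domain H T = {\<omega> \<in> boundary.
    \<forall>e \<in> non_tree_edges H T. \<not> begins_with \<omega> (sigma_minus H T e @ sigma_zero e)}"

end

(* Lift an infinite word to a path from the origin of the Schreier graph and look at its exits, the
   times at which the path uses an edge outside of T. The fundamental domain consists of the words
   without exits. The limit set consists of those with infinitely many: the word of a reduced sequence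
   of Schreier generators is obtained by cancelling, between consecutive generators, the common part
   of the two tree paths, and none of the edges outside of T is cancelled. An element h of H
   only changes a finite initial part of the path, so the words with finitely many exits are exactly
   the ones in the translates; h is determined by the condition that it replaces the initial part by
   a path inside T, as reduced words read along T are determined by their end points. *)

theory Submission
  imports Defs
begin

section \<open>Free reduction\<close>

definition winv :: "'a letter list \<Rightarrow> 'a letter list" where
  "winv w = rev (map linv w)"

lemma winv_simps [simp]: "winv [] = []" "winv (a # w) = winv w @ [linv a]"
  by (simp_all add: winv_def)

lemma linv_neq [simp]: "linv a \<noteq> a" "a \<noteq> linv a"
  by (auto simp: linv_def split: prod.splits)

lemma reduced_append:
  "reduced (u @ v) \<longleftrightarrow> reduced u \<and> reduced v \<and> (u = [] \<or> v = [] \<or> hd v \<noteq> linv (last u))"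
  by (auto simp: reduced_def successively_append_iff)

lemma reduced_winv: "reduced w \<Longrightarrow> reduced (winv w)"
  by (induction w) (auto simp: reduced_Cons reduced_append, auto simp: winv_def last_rev hd_map)

lemma foldr_lcons_id: "reduced (u @ v) \<Longrightarrow> foldr lcons u v = u @ v"
  using free_reduce_append[of v u] free_reduce_id[of "u @ v"] by (simp add: reduced_append)

text \<open>On reduced words each \<open>lcons a\<close> is inverted by
  \<open>lcons (linv a)\<close>; so only \<open>z\<close> has to be reduced, while \<open>w\<close>
  may be any word.\<close>

lemma foldr_lcons_winv: "reduced z \<Longrightarrow> foldr lcons (winv w) (foldr lcons w z) = z"
proof (induction w)
  case (Cons a w)
  then show ?case
    using lcons_linv[of "foldr lcons w z" "linv a"] by (simp add: reduced_foldr_lcons)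
qed simp

lemma winv_winv [simp]: "winv (winv w) = w"
  by (simp add: winv_def rev_map comp_def)

lemma foldr_lcons_winv': "reduced z \<Longrightarrow> foldr lcons w (foldr lcons (winv w) z) = z"
  using foldr_lcons_winv[of z "winv w"] by simp

lemma length_lcons_le: "length (lcons a w) \<le> Suc (length w)"
  by (auto simp: lcons_def)

text \<open>A letter of \<open>u\<close> can cancel at most one letter of \<open>v\<close>.\<close>

lemma length_foldr_lcons_ge: "length v \<le> length (foldr lcons u v) + length u"
proof (induction u)
  case (Cons a u)
  have "length (foldr lcons u v) \<le> Suc (length (lcons a (foldr lcons u v)))"
    by (simp add: lcons_def)
  then show ?case
    using Cons by simp
qed simp

lemma length_free_reduce_le: "length (free_reduce w) \<le> length w"
  by (induction w) (auto simp: free_reduce_def intro: order_trans[OF length_lcons_le])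

text \<open>A cancellation strictly shortens a word. This serves to show that shortest walks in the
  tree have reduced labels.\<close>

lemma reduced_if_length_free_reduce:
  "length w \<le> length (free_reduce w) \<Longrightarrow> reduced w"
proof (induction w)
  case (Cons a w)
  have *: "free_reduce (a # w) = lcons a (free_reduce w)"
    by (simp add: free_reduce_def)
  with Cons.prems have "length w \<le> length (free_reduce w)"
    using length_lcons_le[of a "free_reduce w"] by simp
  then have w: "reduced w"
    by (rule Cons.IH)
  then show ?case
    using Cons.prems * by (auto simp: free_reduce_id reduced_Cons lcons_def split: if_splits)
qed simp

lemma carrier_free_group [simp]: "w \<in> carrier free_group \<longleftrightarrow> reduced w"
  by (simp add: free_group_def)

lemma one_free_group [simp]: "\<one>\<^bsub>free_group\<^esub> = []"
  by (simp add: free_group_def)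

lemma mult_free_group: "reduced v \<Longrightarrow> u \<otimes>\<^bsub>free_group\<^esub> v = foldr lcons u v"
  by (simp add: free_group_def free_reduce_append)

lemma inv_free_group: "reduced w \<Longrightarrow> inv\<^bsub>free_group\<^esub> w = winv w"
  by (rule group.inv_equality[OF group_free_group])
    (use foldr_lcons_winv[of "[]" w] foldr_lcons_id[of w "[]"] in
      \<open>simp_all add: mult_free_group reduced_winv\<close>)


section \<open>The boundary\<close>

text \<open>Lets facts about finite reduced words be applied to infinite words through their
  prefixes.\<close>

lemma boundary_iff: "\<omega> \<in> boundary \<longleftrightarrow> (\<forall>n. reduced (stake n \<omega>))"
proof
  assume \<omega>: "\<omega> \<in> boundary"
  have "reduced (stake n \<omega>)" for n
  proof (induction n)
    case (Suc n)
    then show ?case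
      using \<omega> by (cases n) (auto simp: stake_Suc reduced_append reduced_Cons boundary_def
          infinite_reduced_words_def simp del: stake.simps(2) snth.simps(2))
  qed simp
  then show "\<forall>n. reduced (stake n \<omega>)"
    by blast
next
  assume \<omega>: "\<forall>n. reduced (stake n \<omega>)"
  have "\<omega> !! Suc n \<noteq> linv (\<omega> !! n)" for n
    using \<omega>[rule_format, of "Suc (Suc n)"]
    by (simp add: stake_Suc reduced_append reduced_Cons del: stake.simps(2) snth.simps(2))
  then show "\<omega> \<in> boundary"
    by (simp add: boundary_def infinite_reduced_words_def)
qed

lemma boundary_shift:
  assumes "reduced u" "z \<in> boundary" "u = [] \<or> shd z \<noteq> linv (last u)"
  shows "u @- z \<in> boundary"
  unfolding boundary_iff
proof
  fix n
  have r: "reduced (take n u)"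
    using assms(1) reduced_append[of "take n u" "drop n u"] by simp
  have "hd (stake (n - length u) z) = shd z" if "n > length u"
    using that by (metis stake.simps(2) list.sel(1) Suc_diff_Suc)
  then show "reduced (stake n (u @- z))"
    using assms r by (auto simp: stake_shift reduced_append boundary_iff)
qed

lemma boundary_sdrop: "\<omega> \<in> boundary \<Longrightarrow> sdrop n \<omega> \<in> boundary"
  by (simp add: boundary_def infinite_reduced_words_def sdrop_snth)

lemma scons_shift: "v \<noteq> [] \<Longrightarrow> scons a (v @- z) = lcons a v @- z"
  by (cases v) (auto simp: scons_def lcons_def)

text \<open>A prefix at least as long as \<open>h\<close> absorbs all cancellations: it is still
  nonempty before each letter of \<open>h\<close> acts, so \<open>scons\<close> never reaches into
  the tail.\<close>

lemma act_eq_shift: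
  assumes "length h \<le> n"
  shows "act h \<omega> = foldr lcons h (stake n \<omega>) @- sdrop n \<omega>"
  using assms
proof (induction h)
  case Nil
  then show ?case
    by (simp add: act_def stake_sdrop)
next
  case (Cons a h)
  have "foldr lcons h (stake n \<omega>) \<noteq> []"
    using length_foldr_lcons_ge[of "stake n \<omega>" h] Cons.prems by auto
  then show ?case
    using Cons by (simp add: act_def scons_shift)
qed

lemma scons_boundary:
  assumes "\<omega> \<in> boundary"
  shows "scons a \<omega> \<in> boundary"
proof (cases "shd \<omega> = linv a")
  case True
  then show ?thesis
    using boundary_sdrop[OF assms, of 1] by (simp add: scons_def)
next
  case False
  then show ?thesis
    using boundary_shift[of "[a]" \<omega>] assms by (simp add: scons_def reduced_Cons)
qed

lemma act_boundary: "\<omega> \<in> boundary \<Longrightarrow> act g \<omega> \<in> boundary"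
  unfolding act_def by (induction g) (simp_all add: scons_boundary)

lemma act_foldr_lcons:
  assumes "reduced h" "\<omega> \<in> boundary"
  shows "act g (act h \<omega>) = act (foldr lcons g h) \<omega>"
proof -
  \<comment> \<open>Long enough for \<open>g\<close>, for \<open>h\<close> and for their reduced
    product, and also for \<open>g\<close> to act within what \<open>h\<close> leaves of the prefix.
    The claim becomes associativity on finite words.\<close>
  let ?n = "length g + length h + length (foldr lcons g h)"
  let ?v = "foldr lcons h (stake ?n \<omega>)"
  have len: "length g \<le> length ?v"
    using length_foldr_lcons_ge[of "stake ?n \<omega>" h] by simp
  have "act g (act h \<omega>) = act g (?v @- sdrop ?n \<omega>)"
    by (simp add: act_eq_shift[of h ?n])
  also have "\<dots> = foldr lcons g ?v @- sdrop ?n \<omega>"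
    using act_eq_shift[OF len, of "?v @- sdrop ?n \<omega>"] by (simp add: stake_shift sdrop_shift)
  also have "\<dots> = act (foldr lcons g h) \<omega>"
    using assms by (simp add: act_eq_shift[of _ ?n] foldr_lcons_foldr boundary_iff)
  finally show ?thesis .
qed

lemma stream_eqI: "(\<And>n. s !! n = t !! n) \<Longrightarrow> s = t"
  by (coinduction arbitrary: s t) (metis snth.simps)

lemma converges_to_unique:
  assumes "converges_to g \<omega>" "converges_to g \<omega>'"
  shows "\<omega> = \<omega>'"
proof (rule stream_eqI)
  fix i
  have "\<forall>\<^sub>F n in sequentially. \<omega> !! i = \<omega>' !! i"
    using assms[unfolded converges_to_def, rule_format, of i] by eventually_elim simp
  then show "\<omega> !! i = \<omega>' !! i"
    by simp
qed

lemma prefix_chain_limit: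
  fixes c :: "nat \<Rightarrow> 'l list"
  assumes c: "\<And>n. \<exists>d. d \<noteq> [] \<and> c (Suc n) = c n @ d"
  obtains \<omega> where "\<And>n. stake (length (c n)) \<omega> = c n"
proof -
  have ext: "\<exists>d. c (n + k) = c n @ d" for n k
  proof (induction k)
    case (Suc k)
    then show ?case
      using c[of "n + k"] by auto
  qed simp
  have len: "n \<le> length (c n)" for n
  proof (induction n)
    case (Suc n)
    obtain d where "d \<noteq> []" "c (Suc n) = c n @ d"
      using c by blast
    then show ?case
      using Suc by (cases d) auto
  qed simp
  \<comment> \<open>Each step appends a nonempty word, so \<open>c (Suc i)\<close> has a letter at
    position \<open>i\<close>, and the later words of the chain keep it.\<close>
  define \<omega> where "\<omega> = smap (\<lambda>i. c (Suc i) ! i) nats"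
  have "stake (length (c n)) \<omega> = c n" for n
  proof (rule nth_equalityI)
    fix i assume "i < length (stake (length (c n)) \<omega>)"
    then have i: "i < length (c n)"
      by simp
    obtain d d' where d: "c (n + Suc i) = c n @ d" "c (Suc i + n) = c (Suc i) @ d'"
      using ext by metis
    have "c n ! i = c (n + Suc i) ! i"
      using d i by (simp add: nth_append)
    also have "\<dots> = c (Suc i) ! i"
      using d len[of "Suc i"] by (simp add: nth_append add.commute)
    finally show "stake (length (c n)) \<omega> ! i = c n ! i"
      using i by (simp add: \<omega>_def)
  qed simp
  then show ?thesis
    by (rule that)
qed


section \<open>Paths in the spanning tree\<close>

text \<open>Follows the path letter by letter, so that it also makes sense for unreduced words; for
  a reduced word it is right multiplication of the coset, see \<open>run_eq_coset\<close>.\<close>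

definition run :: "'a letter list set \<Rightarrow> 'a letter list \<Rightarrow> 'a letter list set" where
  "run x w = foldl (\<lambda>y a. y #>\<^bsub>free_group\<^esub> [a]) x w"

lemma run_simps [simp]:
  "run x [] = x"
  "run x (a # w) = run (x #>\<^bsub>free_group\<^esub> [a]) w"
  "run x (u @ v) = run (run x u) v"
  by (simp_all add: run_def)

text \<open>A path in the Schreier graph is determined by its start and its label. Words can
  therefore replace arc lists, and \<open>awalk_iff\<close> translates between the two.\<close>

fun edges :: "'a letter list set \<Rightarrow> 'a letter list \<Rightarrow> 'a edge list" where
  "edges x [] = []"
| "edges x (a # w) = (x, a) # edges (x #>\<^bsub>free_group\<^esub> [a]) w"

lemma length_edges [simp]: "length (edges x w) = length w"
  by (induction w arbitrary: x) auto

lemma map_snd_edges [simp]: "map snd (edges x w) = w"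
  by (induction w arbitrary: x) auto

locale schreier_tree =
  fixes H :: "'a letter list set"
    and T :: "('a letter list set, 'a edge) pre_digraph"
  assumes subgroup: "subgroup H free_group"
    and spanning_tree: "schreier_spanning_tree H T"
begin

abbreviation V :: "'a letter list set set" where
  "V \<equiv> rcosets\<^bsub>free_group\<^esub> H"

lemma V_subset: "x \<in> V \<Longrightarrow> x \<subseteq> carrier free_group"
  using subgroup.rcosets_carrier[OF subgroup group_free_group] .

lemma H_in_V: "H \<in> V"
  using subgroup.subgroup_in_rcosets[OF subgroup group_free_group] .

lemma coset_mult:
  assumes "x \<in> V" "reduced u" "reduced v"
  shows "x #>\<^bsub>free_group\<^esub> u #>\<^bsub>free_group\<^esub> v = x #>\<^bsub>free_group\<^esub> foldr lcons u v"
  using group.coset_mult_assoc[OF group_free_group V_subset, of x u v] assms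
  by (simp add: mult_free_group)

lemma coset_Nil: "x \<in> V \<Longrightarrow> x #>\<^bsub>free_group\<^esub> [] = x"
  using group.coset_mult_one[OF group_free_group V_subset] by simp

lemma coset_in_V: "x \<in> V \<Longrightarrow> reduced w \<Longrightarrow> x #>\<^bsub>free_group\<^esub> w \<in> V"
proof -
  assume x: "x \<in> V" and w: "reduced w"
  obtain g where g: "reduced g" "x = H #>\<^bsub>free_group\<^esub> g"
    using x unfolding RCOSETS_def by auto
  then show ?thesis
    using w coset_mult[OF H_in_V g(1) w] unfolding RCOSETS_def
    by (auto intro!: exI[of _ "foldr lcons g w"] simp: reduced_foldr_lcons)
qed

lemma step_in_V [simp]: "x \<in> V \<Longrightarrow> x #>\<^bsub>free_group\<^esub> [a] \<in> V"
  by (simp add: coset_in_V reduced_Cons)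

lemma step_linv [simp]: "x \<in> V \<Longrightarrow> x #>\<^bsub>free_group\<^esub> [a] #>\<^bsub>free_group\<^esub> [linv a] = x"
  by (simp add: coset_mult reduced_Cons lcons_def coset_Nil)

lemma run_in_V [simp]: "x \<in> V \<Longrightarrow> run x w \<in> V"
  by (induction w arbitrary: x) auto

lemma run_lcons: "x \<in> V \<Longrightarrow> run x (lcons a w) = run (x #>\<^bsub>free_group\<^esub> [a]) w"
  by (cases w) (auto simp: lcons_def)

text \<open>A cancelled pair of letters is a backtracking of the path, so free reduction keeps the
  end point.\<close>

lemma run_foldr_lcons: "x \<in> V \<Longrightarrow> run x (foldr lcons u v) = run x (u @ v)"
  by (induction u arbitrary: x) (auto simp: run_lcons)

lemma run_winv [simp]: "x \<in> V \<Longrightarrow> run (run x w) (winv w) = x"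
  by (induction w arbitrary: x) auto

lemma run_eq_coset: "x \<in> V \<Longrightarrow> reduced w \<Longrightarrow> run x w = x #>\<^bsub>free_group\<^esub> w"
proof (induction w arbitrary: x)
  case (Cons a w)
  then show ?case
    using foldr_lcons_id[of "[a]" w] by (simp add: coset_mult reduced_Cons)
qed (simp add: coset_Nil)

lemma run_H_eq_H_iff: "reduced w \<Longrightarrow> run H w = H \<longleftrightarrow> w \<in> H"
  using group.coset_join1[OF group_free_group _ _ subgroup, of w]
    group.coset_join2[OF group_free_group _ subgroup, of w]
    subgroup.subset[OF subgroup]
  by (auto simp: run_eq_coset H_in_V)

lemma T_spanning: "spanning T (schreier_graph H)"
  and T_rev_image: "edge_rev ` arcs T \<subseteq> arcs T"
  and T_connected: "connected T"
  and T_cycle: "pre_digraph.cycle T p \<Longrightarrow> \<exists>e. p = [e, edge_rev e]"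
  using spanning_tree unfolding schreier_spanning_tree_def by blast+

lemma T_subgraph: "subgraph T (schreier_graph H)"
  using T_spanning by (simp add: spanning_def)

lemma T_wf: "wf_digraph T"
  using T_subgraph by (simp add: subgraph_def)

lemma T_verts: "verts T = V"
  using T_spanning by (simp add: spanning_def schreier_graph_def)

lemma T_arcs: "arcs T \<subseteq> V \<times> UNIV"
  using T_subgraph by (simp add: subgraph_def schreier_graph_def)

lemma T_tail [simp]: "tail T e = fst e"
  and T_head [simp]: "head T e = fst e #>\<^bsub>free_group\<^esub> [snd e]"
proof -
  have "tail (schreier_graph H) = tail T" "head (schreier_graph H) = head T"
    using T_subgraph by (simp_all add: subgraph_def compatible_def)
  then show "tail T e = fst e" "head T e = fst e #>\<^bsub>free_group\<^esub> [snd e]"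
    by (cases e; simp add: schreier_graph_def fun_eq_iff)+
qed

lemma T_rev: "(x, a) \<in> arcs T \<Longrightarrow> (x #>\<^bsub>free_group\<^esub> [a], linv a) \<in> arcs T"
  using T_rev_image unfolding edge_rev_def by force

lemma T_rev_iff: "x \<in> V \<Longrightarrow> (x #>\<^bsub>free_group\<^esub> [a], linv a) \<in> arcs T \<longleftrightarrow> (x, a) \<in> arcs T"
  using T_rev[of x a] T_rev[of "x #>\<^bsub>free_group\<^esub> [a]" "linv a"] by auto

text \<open>\<open>connected\<close> ignores the orientation of arcs; symmetry upgrades it to strong
  connectivity, which yields the directed walks of \<open>tree_word_exists\<close>.\<close>

lemma T_symmetric: "symmetric T"
proof -
  have "(v, u) \<in> arcs_ends T" if "(u, v) \<in> arcs_ends T" for u v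
  proof -
    obtain a where a: "(u, a) \<in> arcs T" "v = u #>\<^bsub>free_group\<^esub> [a]"
      using \<open>(u, v) \<in> arcs_ends T\<close> by (auto simp: arcs_ends_def arc_to_ends_def)
    moreover have "u \<in> V"
      using a T_arcs by auto
    ultimately show ?thesis
      using T_rev[of u a] by (force simp: arcs_ends_def arc_to_ends_def)
  qed
  then show ?thesis
    by (auto simp: symmetric_def sym_def)
qed

fun tree_word :: "'a letter list set \<Rightarrow> 'a letter list \<Rightarrow> bool" where
  "tree_word x [] = True"
| "tree_word x (a # w) = ((x, a) \<in> arcs T \<and> tree_word (x #>\<^bsub>free_group\<^esub> [a]) w)"

lemma tree_word_append [simp]:
  "tree_word x (u @ v) \<longleftrightarrow> tree_word x u \<and> tree_word (run x u) v"
  by (induction u arbitrary: x) auto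

lemma tree_word_lcons: "x \<in> V \<Longrightarrow> tree_word x (a # w) \<Longrightarrow> tree_word x (lcons a w)"
  by (cases w) (auto simp: lcons_def)

text \<open>Free reduction only deletes backtrackings from a path, so no new edge is used.\<close>

lemma tree_word_foldr_lcons:
  "x \<in> V \<Longrightarrow> tree_word x (u @ v) \<Longrightarrow> tree_word x (foldr lcons u v)"
proof (induction u arbitrary: x)
  case (Cons a u)
  then show ?case
    using tree_word_lcons[of x a "foldr lcons u v"] by simp
qed simp

lemma tree_word_winv: "x \<in> V \<Longrightarrow> tree_word x w \<Longrightarrow> tree_word (run x w) (winv w)"
  by (induction w arbitrary: x) (auto simp: T_rev)

lemma awalk_iff:
  assumes "x \<in> V"
  shows "pre_digraph.awalk T x p y \<longleftrightarrow>
    p = edges x (map snd p) \<and> tree_word x (map snd p) \<and> run x (map snd p) = y"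
  using assms
proof (induction p arbitrary: x)
  case Nil
  then show ?case
    by (auto simp: wf_digraph.awalk_Nil_iff[OF T_wf] T_verts)
next
  case (Cons e p)
  then show ?case
    by (cases e) (auto simp: wf_digraph.awalk_Cons_iff[OF T_wf])
qed

lemma awalk_verts_edges:
  "i \<le> length w \<Longrightarrow> pre_digraph.awalk_verts T x (edges x w) ! i = run x (take i w)"
proof (induction w arbitrary: x i)
  case (Cons a w)
  then show ?case
    by (cases i) (auto simp: pre_digraph.awalk_verts.simps)
qed (simp add: pre_digraph.awalk_verts.simps)

text \<open>A shortest nonempty counterexample would be a cycle of \<open>T\<close>.\<close>

lemma closed_tree_word:
  assumes "x \<in> V" "reduced w" "tree_word x w" "run x w = x"
  shows "w = []"
  using assms
proof (induction "length w" arbitrary: x w rule: less_induct)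
  case less
  let ?vs = "pre_digraph.awalk_verts T x (edges x w)"
  have len: "length ?vs = Suc (length w)"
    by (simp add: pre_digraph.length_awalk_verts)
  show ?case
  proof (rule ccontr)
    assume "w \<noteq> []"
    have "distinct (tl ?vs)"
    proof (rule ccontr)
      assume "\<not> distinct (tl ?vs)"
      then obtain i j where "i \<noteq> j" "i < length w" "j < length w" "tl ?vs ! i = tl ?vs ! j"
        using len by (auto simp: distinct_conv_nth)
      then obtain i j where "i < j" "j < length w" "tl ?vs ! i = tl ?vs ! j"
        by (cases i j rule: linorder_cases) auto
      then have ij: "i < j" "j < length w" "run x (take (Suc i) w) = run x (take (Suc j) w)"
        using len by (simp_all add: nth_tl awalk_verts_edges)
      \<comment> \<open>The label of the closed subpath between two visits of the same vertex. It is
        shorter than \<open>w\<close> because the start of the path is not among the vertices in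
        \<open>tl ?vs\<close>.\<close>
      define u where "u = take (j - i) (drop (Suc i) w)"
      define v where "v = drop (Suc j) w"
      have Suc_j: "take (Suc j) w = take (Suc i) w @ u"
        using ij take_add[of "Suc i" "j - i" w] by (simp add: u_def)
      then have w: "w = take (Suc i) w @ u @ v"
        by (metis append_assoc append_take_drop_id v_def)
      have "length u < length w" "u \<noteq> []"
        using ij by (auto simp: u_def)
      moreover have "reduced u"
        using less.prems(2) w reduced_append by metis
      moreover have "tree_word (run x (take (Suc i) w)) u"
        using less.prems(3) w tree_word_append by metis
      moreover have "run (run x (take (Suc i) w)) u = run x (take (Suc i) w)"
        using ij(3) Suc_j by (metis run_simps(3))
      ultimately show False
        using less.hyps[of u "run x (take (Suc i) w)"] less.prems(1) by simp
    qed
    moreover have "pre_digraph.awalk T x (edges x w) x"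
      using less.prems by (simp add: awalk_iff)
    moreover have "edges x w \<noteq> []"
      using \<open>w \<noteq> []\<close> by (cases w) auto
    ultimately have "pre_digraph.cycle T (edges x w)"
      unfolding pre_digraph.cycle_def by blast
    \<comment> \<open>The only cycles allowed in \<open>T\<close> run along an edge and straight
      back, and their labels are not reduced.\<close>
    then obtain e where e: "edges x w = [e, edge_rev e]"
      using T_cycle by blast
    then have "w = [snd e, linv (snd e)]"
      using map_snd_edges[of x w] by (simp add: edge_rev_def split_beta)
    then show False
      using less.prems(2) by (simp add: reduced_Cons)
  qed
qed

text \<open>Going back along \<open>u\<close> and out along \<open>v\<close> is a closed path in
  \<open>T\<close>, so it reduces to the empty word. Hence \<open>u\<close> and \<open>v\<close>
  agree in the free group, and being reduced they are equal.\<close>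

lemma tree_word_unique:
  assumes "x \<in> V" "reduced u" "tree_word x u" "reduced v" "tree_word x v" "run x u = run x v"
  shows "u = v"
proof -
  have "foldr lcons (winv u) v = []"
  proof (rule closed_tree_word)
    show "tree_word (run x u) (foldr lcons (winv u) v)"
      using assms tree_word_winv[of x u] run_winv[of x u]
      by (intro tree_word_foldr_lcons) simp_all
    show "run (run x u) (foldr lcons (winv u) v) = run x u"
      using assms run_winv[of x u] by (simp add: run_foldr_lcons)
  qed (use assms in \<open>simp_all add: reduced_foldr_lcons\<close>)
  then show ?thesis
    using foldr_lcons_winv'[OF assms(4), of u] foldr_lcons_id[of u "[]"] assms(2) by simp
qed

lemma tree_word_exists:
  assumes "x \<in> V" "y \<in> V"
  obtains w where "reduced w" "tree_word x w" "run x w = y"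
proof -
  have "strongly_connected T"
    using wf_digraph.symmetric_connected_imp_strongly_connected[OF T_wf T_symmetric T_connected] .
  then have "x \<rightarrow>\<^sup>*\<^bsub>T\<^esub> y"
    using assms by (simp add: strongly_connected_def T_verts)
  then obtain p where "pre_digraph.awalk T x p y"
    by (auto simp: wf_digraph.reachable_awalk[OF T_wf])
  then have "tree_word x (map snd p)" "run x (map snd p) = y"
    using assms by (simp_all add: awalk_iff)
  then have "tree_word x (free_reduce (map snd p))" "run x (free_reduce (map snd p)) = y"
    using tree_word_foldr_lcons[OF assms(1), of "map snd p" "[]"]
      run_foldr_lcons[OF assms(1), of "map snd p" "[]"]
    by (simp_all add: free_reduce_def)
  then show ?thesis
    using that reduced_free_reduce by blast
qed

text \<open>All walks of \<open>T\<close> from \<open>x\<close> to \<open>y\<close> have labels with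
  the same reduced form \<open>w\<close>. A shortest walk therefore has a reduced label, which is
  \<open>w\<close> itself, and a walk is recovered from its label.\<close>

lemma geodesic_eq:
  assumes "x \<in> V" "reduced w" "tree_word x w" "run x w = y"
  shows "map snd (geodesic T x y) = w"
proof -
  have walk: "pre_digraph.awalk T x (edges x w) y"
    using assms by (simp add: awalk_iff)
  have reduce: "free_reduce (map snd q) = w" if q: "pre_digraph.awalk T x q y" for q
  proof (rule tree_word_unique[OF assms(1)])
    show "tree_word x (free_reduce (map snd q))"
      using q tree_word_foldr_lcons[OF assms(1), of "map snd q" "[]"]
      by (simp add: awalk_iff assms(1) free_reduce_def)
    show "run x (free_reduce (map snd q)) = run x w"
      using q run_foldr_lcons[OF assms(1), of "map snd q" "[]"] assms(4)
      by (simp add: awalk_iff assms(1) free_reduce_def)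
  qed (use assms reduced_free_reduce in auto)
  have "geodesic T x y = edges x w"
    unfolding geodesic_def
  proof (rule the_equality, intro conjI allI impI)
    fix q assume "pre_digraph.awalk T x q y"
    then show "length (edges x w) \<le> length q"
      using reduce[of q] length_free_reduce_le[of "map snd q"] by simp
  next
    fix p
    assume p: "pre_digraph.awalk T x p y \<and>
      (\<forall>q. pre_digraph.awalk T x q y \<longrightarrow> length p \<le> length q)"
    then have "length p \<le> length w"
      using walk length_edges[of x w] by metis
    then have "reduced (map snd p)"
      using reduce[of p] p by (intro reduced_if_length_free_reduce) simp
    then have "map snd p = w"
      using p reduce[of p] by (simp add: free_reduce_id)
    then show "p = edges x w"
      using p awalk_iff[OF assms(1), of p y] by simp
  qed (rule walk)
  then show ?thesis
    by simp
qed


section \<open>Schreier generators\<close>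

text \<open>On vertices this is the Schreier transversal: the coset representative read along the
  tree.\<close>

abbreviation tau :: "'a letter list set \<Rightarrow> 'a letter list" where
  "tau x \<equiv> map snd (geodesic T H x)"

abbreviation gen :: "'a edge \<Rightarrow> 'a letter list" where
  "gen \<equiv> schreier_gen H T"

lemma tau:
  assumes "x \<in> V"
  shows reduced_tau: "reduced (tau x)" and tree_word_tau: "tree_word H (tau x)"
    and run_tau: "run H (tau x) = x"
proof -
  obtain w where w: "reduced w" "tree_word H w" "run H w = x"
    using tree_word_exists[OF H_in_V assms] .
  then have "tau x = w"
    by (rule geodesic_eq[OF H_in_V])
  with w show "reduced (tau x)" "tree_word H (tau x)" "run H (tau x) = x"
    by simp_all
qed

lemma tau_run: "reduced w \<Longrightarrow> tree_word H w \<Longrightarrow> tau (run H w) = w"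
  by (rule geodesic_eq[OF H_in_V _ _ refl])

lemma geodesic_to_H:
  assumes "x \<in> V"
  shows "map snd (geodesic T x H) = winv (tau x)"
  using geodesic_eq[OF assms, of "winv (tau x)" H] tree_word_winv[OF H_in_V, of "tau x"]
    run_winv[OF H_in_V, of "tau x"] tau[OF assms]
  by (simp add: reduced_winv)

lemma non_tree_edges_iff: "(x, a) \<in> non_tree_edges H T \<longleftrightarrow> x \<in> V \<and> (x, a) \<notin> arcs T"
  by (simp add: non_tree_edges_def schreier_graph_def)

lemma sigma_minus_eq: "sigma_minus H T (x, a) = tau x"
  by (simp add: sigma_minus_def schreier_graph_def)

lemma schreier_gen_eq:
  "x \<in> V \<Longrightarrow> gen (x, a) = tau x @ a # winv (tau (x #>\<^bsub>free_group\<^esub> [a]))"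
  by (simp add: schreier_gen_def sigma_minus_eq sigma_zero_def sigma_plus_def
      schreier_graph_def geodesic_to_H)

text \<open>If \<open>a\<close> cancelled the last letter of \<open>t\<close>, its edge would be the
  reverse of an edge of \<open>T\<close> and so lie in \<open>T\<close>.\<close>

lemma reduced_tree_non_tree:
  assumes "y \<in> V" "reduced t" "tree_word y t" "(run y t, a) \<notin> arcs T"
  shows "reduced (t @ [a])"
proof (cases t rule: rev_cases)
  case (snoc t' b)
  then show ?thesis
    using assms T_rev[of "run y t'" b] by (auto simp: reduced_append reduced_Cons)
qed (simp add: reduced_Cons)

text \<open>The reverse of an edge outside \<open>T\<close> is outside \<open>T\<close>, so no tree
  path can start by cancelling \<open>b\<close>.\<close>

lemma reduced_non_tree_tree:
  assumes "y \<in> V" "reduced (c @ [b])" "(run y c, b) \<notin> arcs T"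
    "reduced t" "tree_word (run y (c @ [b])) t"
  shows "reduced ((c @ [b]) @ t)"
proof (cases t)
  case (Cons a t')
  then show ?thesis
    using assms T_rev_iff[of "run y c" b] by (subst reduced_append) auto
qed (use assms in simp)

lemma reduced_schreier_gen:
  assumes "(x, a) \<in> non_tree_edges H T"
  shows "reduced (gen (x, a))"
proof -
  have x: "x \<in> V" "(x, a) \<notin> arcs T"
    using assms by (simp_all add: non_tree_edges_iff)
  let ?y = "x #>\<^bsub>free_group\<^esub> [a]"
  have "tree_word ?y (winv (tau ?y))"
    using tree_word_winv[OF H_in_V, of "tau ?y"] tau[of ?y] x by simp
  moreover have "reduced (tau x @ [a])"
    using x by (intro reduced_tree_non_tree[OF H_in_V]) (simp_all add: tau)
  ultimately have "reduced ((tau x @ [a]) @ winv (tau ?y))"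
    using x by (intro reduced_non_tree_tree[OF H_in_V]) (simp_all add: tau reduced_winv)
  then show ?thesis
    using x by (simp add: schreier_gen_eq)
qed

lemma winv_append: "winv (u @ v) = winv v @ winv u"
  by (simp add: winv_def)

text \<open>Turns the condition on consecutive letters of a reduced word in the generators into one
  on consecutive edges outside \<open>T\<close>.\<close>

lemma inv_schreier_gen:
  assumes "(x, a) \<in> non_tree_edges H T"
  shows "inv\<^bsub>free_group\<^esub> (gen (x, a)) = gen (edge_rev (x, a))"
  using assms
  by (simp add: inv_free_group reduced_schreier_gen, simp add: non_tree_edges_iff
      schreier_gen_eq winv_append edge_rev_def)

lemma edge_rev_non_tree: "e \<in> non_tree_edges H T \<Longrightarrow> edge_rev e \<in> non_tree_edges H T"
  by (cases e) (simp add: non_tree_edges_iff edge_rev_def T_rev_iff)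

text \<open>If one of \<open>u\<close>, \<open>v\<close> were a proper prefix of the other, the edge
  outside \<open>T\<close> that follows the shorter word would lie on the tree path of the longer
  one.\<close>

lemma first_non_tree_letter:
  assumes "tree_word x u" "tree_word x v" "(run x u, a) \<notin> arcs T" "(run x v, b) \<notin> arcs T"
    "u @ a # u' = v @ b # v'"
  shows "u = v \<and> a = b"
  using assms by (auto simp: append_eq_append_conv2 Cons_eq_append_conv append_eq_Cons_conv)

text \<open>The first edge outside \<open>T\<close> on the path of a generator is its defining edge.
  This matters because the letters in \<open>subgroup_boundary\<close> are group elements and not
  edges.\<close>

lemma schreier_gen_inj: "inj_on gen (non_tree_edges H T)"
proof (rule inj_onI)
  fix e f assume ef: "e \<in> non_tree_edges H T" "f \<in> non_tree_edges H T" "gen e = gen f"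
  obtain x a y b where [simp]: "e = (x, a)" "f = (y, b)"
    by (cases e, cases f)
  have "tau x = tau y \<and> a = b"
    using ef by (intro first_non_tree_letter[of H]) (auto simp: non_tree_edges_iff tau schreier_gen_eq)
  then show "e = f"
    using ef run_tau by (metis \<open>e = (x, a)\<close> \<open>f = (y, b)\<close> non_tree_edges_iff)
qed


section \<open>Rays in the Schreier graph\<close>

text \<open>Time \<open>n\<close> refers to the edge taken after \<open>n\<close> letters. The start
  is arbitrary so that tails of a path can be treated too.\<close>

definition exits :: "'a letter list set \<Rightarrow> 'a letter stream \<Rightarrow> nat set" where
  "exits x \<omega> = {n. (run x (stake n \<omega>), \<omega> !! n) \<notin> arcs T}"

lemma tree_word_stake: "tree_word x (stake m \<omega>) \<longleftrightarrow> (\<forall>j<m. j \<notin> exits x \<omega>)"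
  by (induction m)
    (auto simp: stake_Suc exits_def less_Suc_eq simp del: stake.simps(2) snth.simps(2))

lemma exits_sdrop: "exits (run x (stake m \<omega>)) (sdrop m \<omega>) = {j. m + j \<in> exits x \<omega>}"
  by (simp add: exits_def sdrop_snth flip: stake_add)

lemma finite_exits_sdrop:
  "finite (exits (run x (stake m \<omega>)) (sdrop m \<omega>)) \<longleftrightarrow> finite (exits x \<omega>)"
proof
  assume "finite (exits (run x (stake m \<omega>)) (sdrop m \<omega>))"
  then have "finite ({..<m} \<union> (\<lambda>j. m + j) ` {j. m + j \<in> exits x \<omega>})"
    by (simp add: exits_sdrop)
  moreover have "exits x \<omega> \<subseteq> {..<m} \<union> (\<lambda>j. m + j) ` {j. m + j \<in> exits x \<omega>}"
  proof
    fix i assume "i \<in> exits x \<omega>"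
    then show "i \<in> {..<m} \<union> (\<lambda>j. m + j) ` {j. m + j \<in> exits x \<omega>}"
      by (cases "i < m") (auto intro!: image_eqI[of _ _ "i - m"])
  qed
  ultimately show "finite (exits x \<omega>)"
    by (rule finite_subset[rotated])
next
  assume "finite (exits x \<omega>)"
  then show "finite (exits (run x (stake m \<omega>)) (sdrop m \<omega>))"
    using finite_vimageI[of "exits x \<omega>" "\<lambda>j. m + j"] by (simp add: exits_sdrop vimage_def)
qed

text \<open>An element of \<open>H\<close> labels a loop at the origin, so the tail it leaves
  unchanged starts at the same vertex on both paths.\<close>

lemma act_tail:
  assumes "h \<in> H" "length h \<le> n"
  obtains m where "stake m (act h \<omega>) = foldr lcons h (stake n \<omega>)"
    "sdrop m (act h \<omega>) = sdrop n \<omega>" "run H (stake m (act h \<omega>)) = run H (stake n \<omega>)"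
proof -
  let ?v = "foldr lcons h (stake n \<omega>)"
  have "reduced h"
    using assms(1) subgroup.subset[OF subgroup] by auto
  then have "run H ?v = run H (stake n \<omega>)"
    using assms(1) run_H_eq_H_iff[of h] by (simp add: run_foldr_lcons H_in_V)
  then show ?thesis
    using assms(2) by (intro that[of "length ?v"]) (simp_all add: act_eq_shift stake_shift sdrop_shift)
qed

lemma finite_exits_act:
  assumes "h \<in> H"
  shows "finite (exits H (act h \<omega>)) \<longleftrightarrow> finite (exits H \<omega>)"
proof -
  obtain m where "sdrop m (act h \<omega>) = sdrop (length h) \<omega>"
    "run H (stake m (act h \<omega>)) = run H (stake (length h) \<omega>)"
    using act_tail[OF assms order_refl] by metis
  then show ?thesis
    using finite_exits_sdrop[of H m "act h \<omega>"] finite_exits_sdrop[of H "length h" \<omega>] by simp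
qed

text \<open>The letters before a first exit form a reduced tree word, which is \<open>tau\<close> of
  its end point; so the word begins with the forbidden segment of the exit edge. Conversely, such a
  segment ends with an exit.\<close>

lemma fundamental_domain_eq: "fundamental_domain H T = {\<omega> \<in> boundary. exits H \<omega> = {}}"
proof (intro Set.set_eqI iffI)
  fix \<omega> assume \<omega>: "\<omega> \<in> fundamental_domain H T"
  then have bd: "\<omega> \<in> boundary"
    by (simp add: fundamental_domain_def)
  have "n \<notin> exits H \<omega>" for n
  proof (induction n rule: less_induct)
    case (less n)
    let ?x = "run H (stake n \<omega>)"
    have "tau ?x = stake n \<omega>"
      using less bd by (intro tau_run) (simp_all add: tree_word_stake boundary_iff)
    then have "begins_with \<omega> (sigma_minus H T (?x, \<omega> !! n) @ sigma_zero (?x, \<omega> !! n))"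
      by (simp add: begins_with_def sigma_minus_eq sigma_zero_def stake_Suc del: stake.simps(2))
    then have "(?x, \<omega> !! n) \<notin> non_tree_edges H T"
      using \<omega> unfolding fundamental_domain_def by blast
    then show ?case
      by (simp add: non_tree_edges_iff exits_def H_in_V)
  qed
  then show "\<omega> \<in> {\<omega> \<in> boundary. exits H \<omega> = {}}"
    using bd by blast
next
  fix \<omega> assume \<omega>: "\<omega> \<in> {\<omega> \<in> boundary. exits H \<omega> = {}}"
  have False if e: "(x, a) \<in> non_tree_edges H T"
    and b: "begins_with \<omega> (sigma_minus H T (x, a) @ sigma_zero (x, a))" for x a
  proof -
    have "stake (length (tau x)) \<omega> = tau x" "\<omega> !! length (tau x) = a"
      using b by (simp_all add: begins_with_def sigma_minus_eq sigma_zero_def stake_Suc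
          del: stake.simps(2))
    then have "length (tau x) \<in> exits H \<omega>"
      using e by (simp add: exits_def non_tree_edges_iff run_tau del: length_map)
    then show False
      using \<omega> by simp
  qed
  then show "\<omega> \<in> fundamental_domain H T"
    using \<omega> unfolding fundamental_domain_def by auto
qed

section \<open>The limit set: words with infinitely many exits\<close>

text \<open>The product of the first \<open>n\<close> Schreier generators is the prefix \<open>c n\<close> of \<open>\<omega>\<close> that ends with
  the \<open>n\<close>-th letter outside of the tree, followed by the way back to the origin in the tree.\<close>

lemma sigma_infinity_eq:
  assumes e: "\<And>n. (x n, a n) \<in> non_tree_edges H T"
    and c: "c 0 = []" "\<And>n. c (Suc n) = c n @ t n @ [a n]"
    and t: "\<And>n. reduced (t n)" "\<And>n. tree_word (run H (c n)) (t n)"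
      "\<And>n. run H (c n @ t n) = x n"
    and red: "\<And>n. reduced (c n)"
    and pre: "\<And>n. stake (length (c n)) \<omega> = c n"
  shows "\<omega> \<in> boundary \<and> infinite (exits H \<omega>) \<and>
    sigma_infinity (smap (\<lambda>n. gen (x n, a n)) nats) = \<omega>"
proof -
  let ?\<xi> = "smap (\<lambda>n. gen (x n, a n)) nats"
  let ?p = "\<lambda>n. foldl (\<otimes>\<^bsub>free_group\<^esub>) \<one>\<^bsub>free_group\<^esub> (stake n ?\<xi>)"
  have xV: "x n \<in> V" and xT: "(x n, a n) \<notin> arcs T" for n
    using e by (simp_all add: non_tree_edges_iff)
  have len: "n \<le> length (c n)" for n
    by (induction n) (simp_all add: c)
  have runc: "run H (c (Suc n)) = x n #>\<^bsub>free_group\<^esub> [a n]" for n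
    using t(3)[of n] by (simp add: c)
  have bd: "\<omega> \<in> boundary"
    unfolding boundary_iff
  proof
    fix n
    have "stake (length (c n)) \<omega> = stake n \<omega> @ stake (length (c n) - n) (sdrop n \<omega>)"
      using len by simp
    then have "reduced (stake n \<omega> @ stake (length (c n) - n) (sdrop n \<omega>))"
      using red[of n] pre[of n] by simp
    then show "reduced (stake n \<omega>)"
      by (simp only: reduced_append)
  qed
  have inf: "infinite (exits H \<omega>)"
    unfolding infinite_nat_iff_unbounded_le
  proof
    fix n
    \<comment> \<open>The letter \<open>a n\<close> follows \<open>c n @ t n\<close>, so this is the
      time of its exit.\<close>
    let ?k = "length (c n @ t n)"
    have "stake (Suc ?k) \<omega> = (c n @ t n) @ [a n]"
      using pre[of "Suc n"] by (simp add: c del: stake.simps(2))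
    then have "stake ?k \<omega> = c n @ t n" "\<omega> !! ?k = a n"
      by (simp_all add: stake_Suc del: stake.simps(2) length_append)
    then have "?k \<in> exits H \<omega>"
      unfolding exits_def using t(3)[of n] xT by (simp del: length_append)
    moreover have "n \<le> ?k"
      using len[of n] by simp
    ultimately show "\<exists>k\<ge>n. k \<in> exits H \<omega>"
      by blast
  qed
  have prod: "?p n = foldr lcons (c n) (winv (tau (run H (c n))))" for n
  proof (induction n)
    case 0
    then show ?case
      using tau_run[of "[]"] by (simp add: c)
  next
    case (Suc n)
    let ?y = "run H (c n)" and ?z = "run H (c (Suc n))"
    let ?r = "a n # winv (tau ?z)"
    have yV: "?y \<in> V" and zV: "?z \<in> V"
      by (simp_all add: H_in_V)
    have gen: "gen (x n, a n) = tau (x n) @ ?r" "reduced (tau (x n) @ ?r)"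
      using reduced_schreier_gen[OF e[of n]] by (simp_all add: schreier_gen_eq xV runc)
    then have r: "reduced ?r" "reduced (winv (tau ?z))"
      by (simp_all add: reduced_append reduced_Cons)
    \<comment> \<open>The tree path to \<open>?y\<close> continued by \<open>t n\<close> is a tree
      path to \<open>x n\<close>, so it reduces to \<open>tau (x n)\<close>. The return path of the
      preceding product thus cancels against the next generator and leaves \<open>t n\<close>
      followed by \<open>?r\<close>.\<close>
    have "tau (run H (foldr lcons (tau ?y) (t n))) = foldr lcons (tau ?y) (t n)"
      using t(1,2) yV by (intro tau_run tree_word_foldr_lcons)
        (simp_all add: reduced_foldr_lcons H_in_V tau)
    then have tau_x: "tau (x n) = foldr lcons (tau ?y) (t n)"
      using t(3)[of n] yV by (simp add: run_foldr_lcons H_in_V run_tau)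
    have "tau (x n) @ ?r = foldr lcons (tau ?y) (foldr lcons (t n) ?r)"
      using foldr_lcons_id[OF gen(2)] foldr_lcons_foldr[OF t(1)[of n] r(1)] tau_x by simp
    then have cancel: "foldr lcons (winv (tau ?y)) (gen (x n, a n)) = foldr lcons (t n) ?r"
      using gen(1) foldr_lcons_winv[of "foldr lcons (t n) ?r" "tau ?y"] r(1)
      by (simp add: reduced_foldr_lcons)
    have "?p (Suc n) = ?p n \<otimes>\<^bsub>free_group\<^esub> gen (x n, a n)"
      by (simp add: stake_Suc del: stake.simps(2) snth.simps(2))
    also have "\<dots> = foldr lcons (foldr lcons (c n) (winv (tau ?y))) (gen (x n, a n))"
      using Suc gen by (simp add: mult_free_group)
    also have "\<dots> = foldr lcons (c n) (foldr lcons (t n) ?r)"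
      using cancel gen reduced_winv[OF reduced_tau[OF yV]] by (simp add: foldr_lcons_foldr)
    \<comment> \<open>Written this way, the three factors \<open>c n\<close>, \<open>t n\<close> and
      \<open>[a n]\<close> combine to \<open>c (Suc n)\<close>.\<close>
    also have "?r = foldr lcons [a n] (winv (tau ?z))"
      using foldr_lcons_id[of "[a n]" "winv (tau ?z)"] r(1) by simp
    finally show ?case
      by (simp add: c)
  qed
  have prefix: "?p n = c n @ winv (tau (run H (c n)))" for n
  proof (cases n)
    case 0
    then show ?thesis
      using tau_run[of "[]"] by (simp add: c)
  next
    case (Suc m)
    let ?z = "run H (c n)"
    have zV: "?z \<in> V"
      by (simp add: H_in_V)
    \<comment> \<open>For positive \<open>n\<close> the word \<open>c n\<close> ends with a letter
      read outside \<open>T\<close>, which the return path in the tree cannot cancel.\<close>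
    have "reduced (((c m @ t m) @ [a m]) @ winv (tau ?z))"
    proof (rule reduced_non_tree_tree[OF H_in_V])
      show "reduced ((c m @ t m) @ [a m])"
        using red[of n] Suc by (simp add: c)
      show "(run H (c m @ t m), a m) \<notin> arcs T"
        using t(3)[of m] xT[of m] by simp
      show "reduced (winv (tau ?z))"
        using zV by (simp add: reduced_winv reduced_tau)
      have "run H ((c m @ t m) @ [a m]) = run H (tau ?z)"
        using run_tau[OF zV] Suc by (simp add: c)
      then show "tree_word (run H ((c m @ t m) @ [a m])) (winv (tau ?z))"
        using tree_word_winv[OF H_in_V tree_word_tau[OF zV]] by simp
    qed
    then have "reduced (c n @ winv (tau ?z))"
      using Suc by (simp add: c)
    then show ?thesis
      using prod[of n] foldr_lcons_id by simp
  qed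
  have conv: "converges_to ?p \<omega>"
    unfolding converges_to_def
  proof
    fix i
    have "i < length (?p n) \<and> ?p n ! i = \<omega> !! i" if "n \<ge> Suc i" for n
    proof -
      have i: "i < length (c n)"
        using len[of n] that by simp
      then have "\<omega> !! i = c n ! i"
        using pre[of n] stake_nth[of i "length (c n)" \<omega>] by simp
      then show ?thesis
        using i unfolding prefix[of n] by (simp add: nth_append)
    qed
    then show "\<forall>\<^sub>F n in sequentially. i < length (?p n) \<and> ?p n ! i = \<omega> !! i"
      by (intro eventually_sequentiallyI[of "Suc i"])
  qed
  have "sigma_infinity ?\<xi> = \<omega>"
    unfolding sigma_infinity_def
    using bd conv converges_to_unique by (intro the_equality) blast+
  then show ?thesis
    using bd inf by blast
qed

text \<open>The limit word is built directly, by joining the edges of consecutive generators by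
  reduced tree paths. At junctions of an edge outside \<open>T\<close> with a tree path nothing can
  cancel; reducedness of \<open>\<xi>\<close> is used where two edges outside \<open>T\<close> are
  adjacent.\<close>

lemma limit_set_subset:
  assumes "\<xi> \<in> subgroup_boundary H T"
  shows "sigma_infinity \<xi> \<in> boundary \<and> infinite (exits H (sigma_infinity \<xi>))"
proof -
  have "\<forall>n. \<exists>e \<in> non_tree_edges H T. \<xi> !! n = gen e"
    and \<xi>_red: "\<And>n. \<xi> !! Suc n \<noteq> inv\<^bsub>free_group\<^esub> (\<xi> !! n)"
    using assms unfolding subgroup_boundary_def infinite_reduced_words_def schreier_gens_def
    by (auto simp: streams_iff_snth)
  then obtain e where e: "\<And>n. e n \<in> non_tree_edges H T" "\<And>n. \<xi> !! n = gen (e n)"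
    by metis
  define x a where "x n = fst (e n)" and "a n = snd (e n)" for n
  have e_eq: "e n = (x n, a n)" for n
    by (simp add: x_def a_def)
  have xV: "x n \<in> V" and xT: "(x n, a n) \<notin> arcs T" for n
    using e(1)[of n] by (simp_all add: e_eq non_tree_edges_iff)
  \<comment> \<open>The vertex reached after \<open>n\<close> exits; before the first one it is the
    origin.\<close>
  define y where
    "y n = (case n of 0 \<Rightarrow> H | Suc m \<Rightarrow> x m #>\<^bsub>free_group\<^esub> [a m])" for n
  have yV: "y n \<in> V" for n
    by (simp add: y_def H_in_V xV split: nat.split)
  have "\<forall>n. \<exists>w. reduced w \<and> tree_word (y n) w \<and> run (y n) w = x n"
    using tree_word_exists[OF yV xV] by metis
  then obtain t where t: "\<And>n. reduced (t n)" "\<And>n. tree_word (y n) (t n)"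
      "\<And>n. run (y n) (t n) = x n"
    by metis
  define c where "c = rec_nat [] (\<lambda>n u. u @ t n @ [a n])"
  have c: "c 0 = []" "\<And>n. c (Suc n) = c n @ t n @ [a n]"
    by (simp_all add: c_def)
  have run_c: "run H (c n) = y n" for n
    by (induction n) (simp_all add: c t y_def[of 0] y_def[of "Suc _"])
  \<comment> \<open>With an empty tree path in between, a cancellation would make the second edge
    the reverse of the first, and the two generators inverse to each other.\<close>
  have no_back: "a (Suc m) \<noteq> linv (a m)" if "t (Suc m) = []" for m
  proof
    assume "a (Suc m) = linv (a m)"
    then have "e (Suc m) = edge_rev (e m)"
      using that t(3)[of "Suc m"] by (simp add: e_eq edge_rev_def y_def)
    then have "\<xi> !! Suc m = inv\<^bsub>free_group\<^esub> (\<xi> !! m)"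
      using e inv_schreier_gen by (metis e_eq)
    then show False
      using \<xi>_red by blast
  qed
  have red: "reduced (c n)" for n
  proof (induction n)
    case (Suc n)
    have t_a: "reduced (t n @ [a n])"
      using t(3)[of n] xT[of n] by (intro reduced_tree_non_tree[OF yV t(1,2)]) simp
    have tree: "reduced (c n @ t n)"
    proof (cases n)
      case 0
      then show ?thesis
        using t by (simp add: c)
    next
      case (Suc m)
      have "reduced (((c m @ t m) @ [a m]) @ t n)"
      proof (rule reduced_non_tree_tree[OF H_in_V])
        show "reduced ((c m @ t m) @ [a m])"
          using Suc.IH Suc by (simp add: c)
        show "(run H (c m @ t m), a m) \<notin> arcs T"
          using xT[of m] t(3)[of m] by (simp add: run_c)
        show "tree_word (run H ((c m @ t m) @ [a m])) (t n)"
          using t(2)[of n] run_c[of n] Suc by (simp add: c)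
      qed (rule t)
      then show ?thesis
        using Suc by (simp add: c)
    qed
    show ?case
    proof (cases "t n = []")
      case True
      have "c n = [] \<or> a n \<noteq> linv (last (c n))"
        using no_back True by (cases n) (simp_all add: c)
      then show ?thesis
        using Suc True by (simp add: c(2) reduced_append reduced_Cons)
    next
      case False
      then show ?thesis
        using tree t_a Suc by (simp add: c(2) reduced_append reduced_Cons)
    qed
  qed (simp add: c)
  obtain \<omega> where \<omega>: "\<And>n. stake (length (c n)) \<omega> = c n"
    using prefix_chain_limit[of c] c(2) by (metis append_is_Nil_conv not_Cons_self2)
  have "\<xi> = smap (\<lambda>n. gen (x n, a n)) nats"
    by (rule stream_eqI) (simp add: e e_eq)
  moreover have "\<omega> \<in> boundary \<and> infinite (exits H \<omega>) \<and>
      sigma_infinity (smap (\<lambda>n. gen (x n, a n)) nats) = \<omega>"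
  proof (rule sigma_infinity_eq)
    show "(x n, a n) \<in> non_tree_edges H T" for n
      using e(1)[of n] by (simp add: e_eq)
    show "tree_word (run H (c n)) (t n)" for n
      by (simp add: run_c t)
    show "run H (c n @ t n) = x n" for n
      by (simp add: run_c t)
  qed (rule c t red \<omega>)+
  ultimately show ?thesis
    by simp
qed

lemma limit_set_superset:
  assumes bd: "\<omega> \<in> boundary" and inf: "infinite (exits H \<omega>)"
  shows "\<omega> \<in> limit_set H T"
proof -
  let ?S = "exits H \<omega>"
  \<comment> \<open>The first exit at time \<open>m\<close> or later.\<close>
  define k where "k m = (LEAST j. j \<in> ?S \<and> m \<le> j)" for m
  have "\<exists>j. j \<in> ?S \<and> m \<le> j" for m
    using inf unfolding infinite_nat_iff_unbounded_le by blast
  then have k: "k m \<in> ?S" "m \<le> k m" for m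
    unfolding k_def by (metis (mono_tags, lifting) LeastI_ex)+
  have k_least: "j \<notin> ?S" if "m \<le> j" "j < k m" for j m
    using not_less_Least[of j "\<lambda>j. j \<in> ?S \<and> m \<le> j"] that by (simp add: k_def)
  \<comment> \<open>The position right after the first \<open>n\<close> exits, so that
    \<open>t n\<close> is the part between two exits.\<close>
  define b where "b = rec_nat 0 (\<lambda>_ m. Suc (k m))"
  have b: "b 0 = 0" "\<And>n. b (Suc n) = Suc (k (b n))"
    by (simp_all add: b_def)
  define x a where "x n = run H (stake (k (b n)) \<omega>)" and "a n = \<omega> !! k (b n)" for n
  define c t where "c n = stake (b n) \<omega>" and "t n = stake (k (b n) - b n) (sdrop (b n) \<omega>)" for n
  have ct: "c n @ t n = stake (k (b n)) \<omega>" for n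
    using k(2)[of "b n"] by (simp add: c_def t_def)
  have c: "c 0 = []" "\<And>n. c (Suc n) = c n @ t n @ [a n]"
    using ct by (simp_all add: c_def b a_def stake_Suc flip: append_assoc
        del: stake.simps(2) snth.simps(2) stake_add)
  have e: "(x n, a n) \<in> non_tree_edges H T" for n
    using k(1)[of "b n"] by (simp add: non_tree_edges_iff x_def a_def exits_def H_in_V)
  have red: "reduced (c n)" for n
    using bd by (simp add: c_def boundary_iff)
  have t: "reduced (t n)" "tree_word (run H (c n)) (t n)" "run H (c n @ t n) = x n" for n
  proof -
    show "reduced (t n)"
      using bd ct[of n] boundary_iff reduced_append by metis
    show "tree_word (run H (c n)) (t n)"
      using k_least[of "b n"] by (simp add: c_def t_def tree_word_stake exits_sdrop)
    show "run H (c n @ t n) = x n"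
      by (simp only: ct x_def)
  qed
  let ?\<xi> = "smap (\<lambda>n. gen (x n, a n)) nats"
  have lim: "\<omega> = sigma_infinity ?\<xi>"
    using sigma_infinity_eq[of x a c t \<omega>] e c t red by (simp add: c_def)
  have "?\<xi> \<in> subgroup_boundary H T"
    unfolding subgroup_boundary_def infinite_reduced_words_def
  proof (intro CollectI conjI allI)
    show "?\<xi> \<in> streams (schreier_gens H T)"
      using e by (simp add: streams_iff_snth schreier_gens_def)
    fix n
    show "?\<xi> !! Suc n \<noteq> inv\<^bsub>free_group\<^esub> (?\<xi> !! n)"
    proof
      assume "?\<xi> !! Suc n = inv\<^bsub>free_group\<^esub> (?\<xi> !! n)"
      then have "gen (x (Suc n), a (Suc n)) = gen (edge_rev (x n, a n))"
        using e by (simp add: inv_schreier_gen del: snth.simps(2))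
      then have rev: "(x (Suc n), a (Suc n)) = edge_rev (x n, a n)"
        using inj_onD[OF schreier_gen_inj] e edge_rev_non_tree by blast
      have run: "run H (c (Suc n)) = x n #>\<^bsub>free_group\<^esub> [a n]"
        using t(3)[of n] by (simp add: c)
      \<comment> \<open>If the two exit edges are mutually reverse, the tree path between them is
        closed and hence empty. Their letters would then be adjacent and inverse in the reduced word
        \<open>\<omega>\<close>.\<close>
      then have "t (Suc n) = []"
        using t[of "Suc n"] rev run run_in_V[OF H_in_V, of "c (Suc n)"] by (intro closed_tree_word[of "run H (c (Suc n))"])
          (simp_all add: edge_rev_def)
      then show False
        using red[of "Suc (Suc n)"] rev
        by (simp add: c edge_rev_def reduced_append reduced_Cons)
    qed
  qed
  then show ?thesis
    unfolding limit_set_def by (rule rev_image_eqI) (rule lim)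
qed

lemma limit_set_eq: "limit_set H T = {\<omega> \<in> boundary. infinite (exits H \<omega>)}"
proof (intro equalityI subsetI)
  fix \<omega> assume "\<omega> \<in> limit_set H T"
  then show "\<omega> \<in> {\<omega> \<in> boundary. infinite (exits H \<omega>)}"
    unfolding limit_set_def using limit_set_subset by auto
qed (simp add: limit_set_superset)

section \<open>Translates of the fundamental domain\<close>

lemma translates_cover:
  assumes "\<omega> \<in> boundary" "finite (exits H \<omega>)"
  shows "\<exists>h\<in>H. \<omega> \<in> act h ` fundamental_domain H T"
proof -
  obtain n where n: "\<And>j. j \<in> exits H \<omega> \<Longrightarrow> j < n"
    using assms(2) by (auto simp: finite_nat_set_iff_bounded)
  let ?u = "stake n \<omega>" and ?z = "sdrop n \<omega>"
  let ?x = "run H ?u"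
  have xV: "?x \<in> V"
    by (simp add: H_in_V)
  have u: "reduced ?u"
    using assms(1) by (simp add: boundary_iff)
  let ?v = "tau ?x"
  \<comment> \<open>All exits occur within \<open>?u\<close>. Replacing \<open>?u\<close> by the
    tree path \<open>?v\<close> to the same vertex removes them, and \<open>?h\<close> is the loop
    at the origin that undoes the replacement.\<close>
  let ?h = "foldr lcons ?u (winv ?v)"
  have h: "reduced ?h"
    by (simp add: reduced_foldr_lcons reduced_winv reduced_tau xV)
  have "run H ?h = H"
    using run_winv[OF H_in_V, of ?v] by (simp add: run_foldr_lcons H_in_V run_tau xV)
  then have hH: "?h \<in> H"
    using h by (simp add: run_H_eq_H_iff)
  have z: "?z \<in> boundary" "exits ?x ?z = {}"
    using assms(1) n by (auto simp: boundary_sdrop exits_sdrop dest: n)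
  define \<omega>' where "\<omega>' = act ?v ?z"
  have bd': "\<omega>' \<in> boundary"
    using z by (simp add: \<omega>'_def act_boundary)
  have tree: "exits H \<omega>' = {}"
  proof -
    have "j \<notin> exits H \<omega>'" for j
    proof -
      \<comment> \<open>Covers the length of \<open>?v\<close>, as \<open>act_eq_shift\<close>
        demands, and leaves more than \<open>j\<close> letters after the cancellations between
        \<open>?v\<close> and \<open>?z\<close>.\<close>
      let ?m = "Suc j + 2 * length ?v"
      let ?p = "foldr lcons ?v (stake ?m ?z)"
      have "\<omega>' = ?p @- sdrop ?m ?z"
        unfolding \<omega>'_def by (rule act_eq_shift) simp
      then have "stake (length ?p) \<omega>' = ?p"
        by (simp add: stake_shift)
      moreover have "tree_word H ?p"
        using z by (intro tree_word_foldr_lcons[OF H_in_V])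
          (simp del: stake.simps(2) add: tau xV tree_word_stake)
      moreover have "j < length ?p"
        using length_foldr_lcons_ge[of "stake ?m ?z" ?v] by simp
      ultimately show ?thesis
        using tree_word_stake[of H "length ?p" \<omega>'] by simp
    qed
    then show ?thesis
      by blast
  qed
  have "act ?h \<omega>' = act (foldr lcons ?h ?v) ?z"
    unfolding \<omega>'_def using xV z by (simp add: act_foldr_lcons reduced_tau)
  also have "foldr lcons ?h ?v = ?u"
    using xV u foldr_lcons_id[of ?v "[]"] foldr_lcons_winv[of "[]" ?v] foldr_lcons_id[of ?u "[]"]
    by (simp add: foldr_lcons_foldr reduced_winv reduced_tau)
  also have "act ?u ?z = \<omega>"
  proof -
    have "foldr lcons ?u (stake n ?z) = ?u @ stake n ?z"
      using assms(1) by (intro foldr_lcons_id) (simp add: boundary_iff)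
    then show ?thesis
      using act_eq_shift[of ?u n ?z] by (simp add: stake_sdrop del: stake_add sdrop_add)
  qed
  finally show ?thesis
    using hH bd' tree by (force simp: fundamental_domain_eq)
qed

text \<open>Both paths stay in \<open>T\<close> and reach the start of their common tail at the same
  vertex. By uniqueness of reduced tree words the prefixes coincide, so \<open>h\<close> fixes
  \<open>?u\<close> under multiplication and is trivial.\<close>

lemma fundamental_domain_act_eq:
  assumes "h \<in> H" "\<omega> \<in> fundamental_domain H T" "act h \<omega> \<in> fundamental_domain H T"
  shows "h = []"
proof -
  let ?u = "stake (length h) \<omega>"
  obtain m where m: "stake m (act h \<omega>) = foldr lcons h ?u"
      "run H (stake m (act h \<omega>)) = run H ?u"
    using act_tail[OF assms(1) order_refl] by metis
  have "foldr lcons h ?u = ?u"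
  proof (rule tree_word_unique[OF H_in_V])
    show "reduced (foldr lcons h ?u)" "reduced ?u"
      using assms(2,3) by (simp_all add: fundamental_domain_eq boundary_iff flip: m(1))
    show "tree_word H (foldr lcons h ?u)" "tree_word H ?u"
      using assms(2,3) by (simp_all add: fundamental_domain_eq tree_word_stake flip: m(1))
    show "run H (foldr lcons h ?u) = run H ?u"
      using m by simp
  qed
  moreover have "reduced h" "reduced ?u"
    using assms(1,2) subgroup.subset[OF subgroup] by (auto simp: fundamental_domain_eq boundary_iff)
  ultimately have "h \<otimes>\<^bsub>free_group\<^esub> ?u = \<one>\<^bsub>free_group\<^esub> \<otimes>\<^bsub>free_group\<^esub> ?u"
    by (simp add: mult_free_group)
  then show ?thesis
    using group.right_cancel[OF group_free_group, of ?u h "\<one>\<^bsub>free_group\<^esub>"]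
      \<open>reduced h\<close> \<open>reduced ?u\<close> by simp
qed

text \<open>The quotient of \<open>g\<close> by \<open>h\<close> carries one point of the
  fundamental domain to another, so it is trivial by
  \<open>fundamental_domain_act_eq\<close>.\<close>

lemma translates_disjoint:
  assumes "g \<in> H" "h \<in> H" "act g \<omega> = act h \<omega>'"
    "\<omega> \<in> fundamental_domain H T" "\<omega>' \<in> fundamental_domain H T"
  shows "g = h"
proof -
  have red: "reduced g" "reduced h"
    using assms(1,2) subgroup.subset[OF subgroup] by auto
  have bd: "\<omega> \<in> boundary" "\<omega>' \<in> boundary"
    using assms(4,5) by (simp_all add: fundamental_domain_eq)
  let ?k = "foldr lcons (winv h) g"
  have k: "?k = inv\<^bsub>free_group\<^esub> h \<otimes>\<^bsub>free_group\<^esub> g"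
    using red by (simp add: mult_free_group inv_free_group)
  have "?k \<in> H"
    unfolding k using assms(1,2) subgroup
    by (intro subgroup.m_closed[OF subgroup] subgroup.m_inv_closed[OF subgroup])
  moreover have "act ?k \<omega> = \<omega>'"
  proof -
    have "act ?k \<omega> = act (winv h) (act h \<omega>')"
      using act_foldr_lcons[OF red(1) bd(1), of "winv h"] assms(3) by simp
    also have "\<dots> = \<omega>'"
      using act_foldr_lcons[OF red(2) bd(2), of "winv h"] foldr_lcons_winv[of "[]" h]
        foldr_lcons_id[of h "[]"] red by (simp add: act_def)
    finally show ?thesis .
  qed
  ultimately have "?k = []"
    using fundamental_domain_act_eq assms(4,5) by simp
  then show ?thesis
    using foldr_lcons_winv'[OF red(1), of h] foldr_lcons_id[of h "[]"] red by simp
qed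

end

theorem theorem1p21:
  fixes H :: "'a :: finite letter list set"
    and T :: "('a letter list set, 'a edge) pre_digraph"
  assumes "CARD('a) \<ge> 2"
    and "subgroup H free_group"
    and "schreier_spanning_tree H T"
  shows "boundary = (\<Union>h\<in>H. act h ` fundamental_domain H T) \<union> limit_set H T
    \<and> disjoint_family_on (\<lambda>h. act h ` fundamental_domain H T) H
    \<and> (\<forall>h\<in>H. act h ` fundamental_domain H T \<inter> limit_set H T = {})"
proof -
  interpret schreier_tree H T
    using assms(2,3) by (rule schreier_tree.intro)
  \<comment> \<open>Elements of \<open>H\<close> preserve finiteness of the set of exits; this keeps
    every translate apart from the limit set.\<close>
  have translate: "act h \<omega> \<in> boundary \<and> finite (exits H (act h \<omega>))"
    if "h \<in> H" "\<omega> \<in> fundamental_domain H T" for h \<omega>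
    using that by (simp add: fundamental_domain_eq finite_exits_act act_boundary)
  have "boundary = (\<Union>h\<in>H. act h ` fundamental_domain H T) \<union> limit_set H T"
    using translates_cover translate by (auto simp: limit_set_eq)
  moreover have "disjoint_family_on (\<lambda>h. act h ` fundamental_domain H T) H"
    using translates_disjoint by (fastforce simp: disjoint_family_on_def)
  moreover have "\<forall>h\<in>H. act h ` fundamental_domain H T \<inter> limit_set H T = {}"
    using translate by (auto simp: limit_set_eq)
  ultimately show ?thesis
    by blast
qed

end
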